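(* Let $n\geq2$, $d\geq1$, $\Omega\subset\mathbb{R}^n$ open and $f:\Omega\to\mathbb{R}^d$ continuous. If for some gauge function $\varphi$ there is a set $N\subset\Omega$ with $\mathcal{H}^\varphi(N)=0$ and $\mathcal{H}^n(f(N))>0$, then there is a Cantor set $K\subset\Omega$ such that $\mathcal{H}^\varphi(K)=0$ and $\mathcal{H}^n(f(K))>0$.
   Context: A Cantor set is a nonempty compact, perfect, totally disconnected set. A gauge function is a nondecreasing $h:[0,\infty]\to[0,\infty]$, positive on $(0,\infty]$ and right-continuous; $\mathcal{H}^h(A)=\lim_{\delta\to0}\inf\{\sum_j h(\operatorname{diam}C_j): A\subset\bigcup_jC_j,\ \operatorname{diam}C_j\leq\delta\}$, and $\mathcal{H}^n$ is the case $h(t)=t^n$ (in $\mathbb{R}^d$). *)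

theory Defs
  imports "HOL-Analysis.Analysis"
begin

text \<open>Gauge function: nondecreasing on [0,oo), values in [0,oo], positive on (0,oo),
  right-continuous.  (Only finite arguments are ever used in the Hausdorff measure.)\<close>
definition gauge_function :: "(real \<Rightarrow> ennreal) \<Rightarrow> bool" where
  "gauge_function h \<longleftrightarrow>
     mono_on {0..} h \<and> (\<forall>t>0. h t > 0) \<and> (\<forall>t\<ge>0. (h \<longlongrightarrow> h t) (at_right t))"

text \<open>Size-delta approximating Hausdorff content: infimum over countable covers by
  bounded sets of diameter at most delta (empty members contribute nothing, so finite
  covers are included).\<close>
definition hausdorff_approx :: "(real \<Rightarrow> ennreal) \<Rightarrow> real \<Rightarrow> 'a::metric_space set \<Rightarrow> ennreal" where
  "hausdorff_approx h \<delta> A =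
     (INF C \<in> {C :: nat \<Rightarrow> 'a set. A \<subseteq> (\<Union>j. C j) \<and>
                 (\<forall>j. bounded (C j) \<and> diameter (C j) \<le> \<delta>)}.
        (\<Sum>j. if C j = {} then 0 else h (diameter (C j))))"

text \<open>Hausdorff measure H^h; the limit as delta -> 0 equals the supremum (monotone).\<close>
definition hausdorff_measure :: "(real \<Rightarrow> ennreal) \<Rightarrow> 'a::metric_space set \<Rightarrow> ennreal" where
  "hausdorff_measure h A = (SUP \<delta> \<in> {0<..}. hausdorff_approx h \<delta> A)"

definition totally_disconnected :: "'a::topological_space set \<Rightarrow> bool" where
  "totally_disconnected K \<longleftrightarrow> (\<forall>x\<in>K. connected_component_set K x = {x})"

definition perfect_set :: "'a::topological_space set \<Rightarrow> bool" where
  "perfect_set K \<longleftrightarrow> closed K \<and> (\<forall>x\<in>K. x islimpt K)"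

definition cantor_set :: "'a::metric_space set \<Rightarrow> bool" where
  "cantor_set K \<longleftrightarrow> K \<noteq> {} \<and> compact K \<and> perfect_set K \<and> totally_disconnected K"

end

theory Submission
  imports Defs
begin

text \<open>The \<open>\<H>\<^sup>n\<close>-null sets are the null sets of the content obtained from covers by
  dyadic cubes. Since two dyadic cubes are nested or disjoint, this content is strongly subadditive,
  hence continuous along increasing sequences of arbitrary sets. The set \<open>N\<close> sits in a \<open>\<phi>\<close>-null
  \<open>G\<^sub>\<delta>\<close> set; after discarding part of \<open>N\<close>, each coordinate moreover avoids a countable dense
  set, a condition that is again \<open>G\<^sub>\<delta>\<close> and that forces total disconnectedness. Choquet's
  capacitability argument gives a compact subset of the \<open>G\<^sub>\<delta>\<close> set whose image is not null, and its
  Cantor--Bendixson kernel differs from it by a countable set only.\<close>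

section \<open>Contents from laminar families\<close>

text \<open>Weights of covers are encoded as a measure \<open>\<mu>\<close> on the power set of the
  cells, so that modularity and continuity from below apply to families of cells.
  \<open>finite_supersets\<close> serves to put every nonempty cell inside a maximal one.\<close>

locale laminar_family =
  fixes \<Q> :: "'b set set" and \<mu> :: "'b set measure"
  assumes sets_eq: "sets \<mu> = UNIV"
    and nested: "\<lbrakk>Q \<in> \<Q>; R \<in> \<Q>; x \<in> Q; x \<in> R\<rbrakk> \<Longrightarrow> Q \<subseteq> R \<or> R \<subseteq> Q"
    and finite_supersets: "\<lbrakk>Q \<in> \<Q>; x \<in> Q\<rbrakk> \<Longrightarrow> finite {R \<in> \<Q>. Q \<subseteq> R}"
begin

definition cover_content :: "'b set \<Rightarrow> ennreal" where
  "cover_content A = (INF \<C> \<in> {\<C>. \<C> \<subseteq> \<Q> \<and> A \<subseteq> \<Union>\<C>}. emeasure \<mu> \<C>)"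

definition maximals :: "'b set set \<Rightarrow> 'b set set" where
  "maximals \<S> = {Q \<in> \<S>. \<forall>R\<in>\<S>. Q \<subseteq> R \<longrightarrow> R = Q}"

lemma cover_content_le: "\<lbrakk>\<C> \<subseteq> \<Q>; A \<subseteq> \<Union>\<C>\<rbrakk> \<Longrightarrow> cover_content A \<le> emeasure \<mu> \<C>"
  unfolding cover_content_def by (rule INF_lower) auto

lemma cover_content_lessD:
  assumes "cover_content A < c"
  obtains \<C> where "\<C> \<subseteq> \<Q>" "A \<subseteq> \<Union>\<C>" "emeasure \<mu> \<C> < c"
  using assms unfolding cover_content_def by (auto simp: INF_less_iff)

lemma cover_content_mono: "A \<subseteq> B \<Longrightarrow> cover_content A \<le> cover_content B"
  unfolding cover_content_def by (rule INF_superset_mono) auto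

lemma cover_content_approx:
  assumes "cover_content A < top" "0 < e"
  obtains \<C> where "\<C> \<subseteq> \<Q>" "A \<subseteq> \<Union>\<C>" "emeasure \<mu> \<C> \<le> cover_content A + e"
proof -
  have "cover_content A < cover_content A + e"
    using assms by (simp add: ennreal_less_zero_iff less_top[symmetric])
  then show thesis
    using that cover_content_lessD by (metis less_imp_le)
qed

lemma cover_content_UN_le:
  fixes A :: "nat \<Rightarrow> 'b set"
  shows "cover_content (\<Union>j. A j) \<le> (\<Sum>j. cover_content (A j))"
proof (cases "(\<Sum>j. cover_content (A j)) = top")
  case False
  have fin: "cover_content (A j) < top" for j
  proof -
    have "cover_content (A j) \<le> (\<Sum>j. cover_content (A j))"
      using sum_le_suminf[of "\<lambda>j. cover_content (A j)" "{j}"] by (auto simp: summableI)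
    then show ?thesis using False by (metis le_less_trans less_top)
  qed
  show ?thesis
  proof (rule ennreal_le_epsilon)
    fix e :: real assume "0 < e"
    define \<epsilon> where "\<epsilon> j = ennreal (e * (1/2) ^ Suc j)" for j
    have "\<exists>\<C>. \<C> \<subseteq> \<Q> \<and> A j \<subseteq> \<Union>\<C> \<and> emeasure \<mu> \<C> \<le> cover_content (A j) + \<epsilon> j" for j
      using cover_content_approx[OF fin[of j], of "\<epsilon> j"] \<open>0 < e\<close> unfolding \<epsilon>_def
      by (metis ennreal_less_zero_iff zero_less_power half_gt_zero_iff zero_less_one mult_pos_pos)
    then obtain \<C> where \<C>: "\<And>j. \<C> j \<subseteq> \<Q>" "\<And>j. A j \<subseteq> \<Union>(\<C> j)"
      "\<And>j. emeasure \<mu> (\<C> j) \<le> cover_content (A j) + \<epsilon> j" by metis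
    have "cover_content (\<Union>j. A j) \<le> emeasure \<mu> (\<Union>j. \<C> j)"
    proof (rule cover_content_le)
      show "(\<Union>j. A j) \<subseteq> \<Union>(\<Union>j. \<C> j)"
        proof
        fix x assume "x \<in> (\<Union>j. A j)"
        then obtain j where "x \<in> A j" by blast
        then obtain Q where "Q \<in> \<C> j" "x \<in> Q" using \<C>(2)[of j] by blast
        then show "x \<in> \<Union>(\<Union>j. \<C> j)" by blast
      qed
    qed (use \<C>(1) in auto)
    also have "\<dots> \<le> (\<Sum>j. emeasure \<mu> (\<C> j))"
      by (rule emeasure_subadditive_countably) (simp add: sets_eq)
    also have "\<dots> \<le> (\<Sum>j. cover_content (A j) + \<epsilon> j)"
      by (intro suminf_le \<C>(3) summableI)
    also have "\<dots> = (\<Sum>j. cover_content (A j)) + (\<Sum>j. \<epsilon> j)"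
      by (simp add: suminf_add summableI)
    also have "(\<Sum>j. \<epsilon> j) = ennreal e"
      unfolding \<epsilon>_def using sums_mult[OF power_half_series, of e] \<open>0 < e\<close>
      by (intro suminf_ennreal_eq) auto
    finally show "cover_content (\<Union>j. A j) \<le> (\<Sum>j. cover_content (A j)) + ennreal e" .
  qed
qed simp

lemma cover_content_Un_null:
  assumes "cover_content A = 0" "cover_content B = 0"
  shows "cover_content (A \<union> B) = 0"
proof -
  have "cover_content (A \<union> B) \<le> (\<Sum>j. cover_content (if j = (0::nat) then A else B))"
    by (rule order_trans[OF cover_content_mono cover_content_UN_le]) (auto split: if_splits)
  also have "(\<lambda>j. cover_content (if j = (0::nat) then A else B)) = (\<lambda>j. 0)"
    using assms by auto
  finally show ?thesis by simp
qed

text \<open>A nonempty cell has finitely many supersets in the family, and a maximal one among these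
  is maximal in all of \<open>\<S>\<close>. The point \<open>x\<close> witnesses
  nonemptiness.\<close>

lemma maximals_above:
  assumes "\<S> \<subseteq> \<Q>" "Q \<in> \<S>" "x \<in> Q"
  obtains R where "R \<in> maximals \<S>" "Q \<subseteq> R"
proof -
  have "finite {R \<in> \<S>. Q \<subseteq> R}"
    by (rule finite_subset[OF _ finite_supersets[of Q x]]) (use assms in auto)
  from finite_has_maximal2[OF this, of Q] assms(2)
  obtain R where R: "R \<in> \<S>" "Q \<subseteq> R"
    "\<forall>T\<in>{R \<in> \<S>. Q \<subseteq> R}. R \<subseteq> T \<longrightarrow> R = T" by auto
  have "R \<in> maximals \<S>"
    unfolding maximals_def
  proof (intro CollectI conjI ballI impI)
    fix T assume "T \<in> \<S>" "R \<subseteq> T"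
    then have "R = T" using R(2) by (intro R(3)[rule_format]) auto
    then show "T = R" ..
  qed (rule R)
  then show thesis using R(2) that by blast
qed

lemma Union_maximals: "\<S> \<subseteq> \<Q> \<Longrightarrow> \<Union>(maximals \<S>) = \<Union>\<S>"
proof (intro subset_antisym subsetI)
  fix x assume "\<S> \<subseteq> \<Q>" "x \<in> \<Union>\<S>"
  then show "x \<in> \<Union>(maximals \<S>)" using maximals_above by (metis UnionE UnionI subsetD)
qed (auto simp: maximals_def)

text \<open>Of two cells through a point of \<open>A \<inter> B\<close>, one from each cover, the smaller one is either
  non-maximal or shared by both covers; so the cells not used for \<open>A \<union> B\<close> still cover \<open>A \<inter> B\<close>.\<close>
lemma cover_content_strong_subadditive:
  assumes "\<A> \<subseteq> \<Q>" "\<B> \<subseteq> \<Q>" "A \<subseteq> \<Union>\<A>" "A \<subseteq> \<Union>\<B>"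
  shows "emeasure \<mu> (maximals (\<A> \<union> \<B>)) + cover_content A \<le> emeasure \<mu> \<A> + emeasure \<mu> \<B>"
proof -
  define \<S> where "\<S> = \<A> \<union> \<B>"
  define \<R> where "\<R> = (\<S> - maximals \<S>) \<union> (\<A> \<inter> \<B>)"
  have ms: "maximals \<S> \<subseteq> \<S>" by (auto simp: maximals_def)
  have "A \<subseteq> \<Union>\<R>"
  proof
    fix x assume "x \<in> A"
    then obtain Q R where QR: "Q \<in> \<A>" "R \<in> \<B>" "x \<in> Q" "x \<in> R" using assms by blast
    then have "Q \<subseteq> R \<or> R \<subseteq> Q" using nested assms by blast
    then have "Q \<in> \<R> \<or> R \<in> \<R>"
      using QR unfolding \<R>_def \<S>_def maximals_def by (cases "Q = R") auto
    then show "x \<in> \<Union>\<R>" using QR by auto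
  qed
  then have "cover_content A \<le> emeasure \<mu> \<R>"
    using assms by (intro cover_content_le) (auto simp: \<R>_def \<S>_def)
  also have "\<dots> \<le> emeasure \<mu> (\<S> - maximals \<S>) + emeasure \<mu> (\<A> \<inter> \<B>)"
    unfolding \<R>_def by (rule emeasure_subadditive) (auto simp: sets_eq)
  finally have "emeasure \<mu> (maximals \<S>) + cover_content A
      \<le> (emeasure \<mu> (maximals \<S>) + emeasure \<mu> (\<S> - maximals \<S>)) + emeasure \<mu> (\<A> \<inter> \<B>)"
    by (simp add: add.assoc add_left_mono)
  also have "emeasure \<mu> (maximals \<S>) + emeasure \<mu> (\<S> - maximals \<S>) = emeasure \<mu> \<S>"
    using ms by (subst plus_emeasure) (auto simp: sets_eq Un_absorb1)
  \<comment> \<open>Modularity of \<open>\<mu>\<close>: a cell common to both covers is counted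
    twice on either side.\<close>
  also have "emeasure \<mu> \<S> + emeasure \<mu> (\<A> \<inter> \<B>) = emeasure \<mu> \<A> + emeasure \<mu> \<B>"
    unfolding \<S>_def by (rule emeasure_Un_Int[symmetric]) (auto simp: sets_eq)
  finally show ?thesis unfolding \<S>_def .
qed

text \<open>Near-optimal covers of the \<open>E k\<close> are merged one after the other, keeping
  only maximal cells. Strong subadditivity lets the errors add up to at most \<open>e\<close>. The
  cells that survive from some stage on cover the union, and their total weight is a limit from
  below.\<close>

lemma cover_content_UN_incseq_le:
  fixes E :: "nat \<Rightarrow> 'b set"
  assumes "incseq E" and bound: "\<And>k. cover_content (E k) \<le> c" and "c < top"
  shows "cover_content (\<Union>k. E k) \<le> c"
proof (rule ennreal_le_epsilon)
  fix e :: real assume "0 < e"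
  define \<epsilon> where "\<epsilon> j = ennreal (e * (1/2) ^ Suc j)" for j
  have fin: "cover_content (E k) < top" for k using bound[of k] \<open>c < top\<close> by (rule le_less_trans)
  have "\<exists>\<C>. \<C> \<subseteq> \<Q> \<and> E j \<subseteq> \<Union>\<C> \<and> emeasure \<mu> \<C> \<le> cover_content (E j) + \<epsilon> j" for j
    using cover_content_approx[OF fin[of j], of "\<epsilon> j"] \<open>0 < e\<close> unfolding \<epsilon>_def
    by (metis ennreal_less_zero_iff zero_less_power half_gt_zero_iff zero_less_one mult_pos_pos)
  then obtain \<C> where \<C>: "\<And>j. \<C> j \<subseteq> \<Q>" "\<And>j. E j \<subseteq> \<Union>(\<C> j)"
    "\<And>j. emeasure \<mu> (\<C> j) \<le> cover_content (E j) + \<epsilon> j" by metis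
  define \<D> where "\<D> = rec_nat (maximals (\<C> 0)) (\<lambda>k D. maximals (D \<union> \<C> (Suc k)))"
  have D0: "\<D> 0 = maximals (\<C> 0)" and DS: "\<And>k. \<D> (Suc k) = maximals (\<D> k \<union> \<C> (Suc k))"
    by (simp_all add: \<D>_def)
  have msub: "maximals \<S> \<subseteq> \<S>" for \<S> by (auto simp: maximals_def)
  have DQ: "\<D> k \<subseteq> \<Q>" for k
  proof (induction k)
    case 0
    show ?case unfolding D0 using msub \<C>(1) by (rule order_trans)
  next
    case (Suc k)
    show ?case unfolding DS by (rule order_trans[OF msub]) (simp add: Suc \<C>(1))
  qed
  have Dcov: "E k \<subseteq> \<Union>(\<D> k)" for k
  proof (cases k)
    case (Suc j)
    have "\<Union>(\<D> k) = \<Union>(\<D> j \<union> \<C> k)"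
      unfolding Suc DS by (rule Union_maximals) (use DQ \<C>(1) in auto)
    then show ?thesis using \<C>(2)[of k] by auto
  qed (use \<C> Union_maximals in \<open>auto simp: D0\<close>)
  have Dle: "emeasure \<mu> (\<D> k) \<le> cover_content (E k) + (\<Sum>j\<le>k. \<epsilon> j)" for k
  proof (induction k)
    case 0
    have "emeasure \<mu> (\<D> 0) \<le> emeasure \<mu> (\<C> 0)"
      unfolding D0 by (rule emeasure_mono[OF msub]) (simp add: sets_eq)
    then show ?case using \<C>(3)[of 0] by simp
  next
    case (Suc k)
    have "E k \<subseteq> E (Suc k)" using \<open>incseq E\<close> by (simp add: incseq_SucD)
    \<comment> \<open>Both \<open>\<D> k\<close> and \<open>\<C> (Suc k)\<close> cover
      \<open>E k\<close>. Its content is finite and gets cancelled below, so the only new error is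
      \<open>\<epsilon> (Suc k)\<close>.\<close>
    then have "emeasure \<mu> (\<D> (Suc k)) + cover_content (E k) \<le> emeasure \<mu> (\<D> k) + emeasure \<mu> (\<C> (Suc k))"
      unfolding DS using DQ \<C>(1) Dcov \<C>(2) by (intro cover_content_strong_subadditive) blast+
    also have "\<dots> \<le> (cover_content (E k) + (\<Sum>j\<le>k. \<epsilon> j)) + (cover_content (E (Suc k)) + \<epsilon> (Suc k))"
      by (intro add_mono Suc \<C>(3))
    also have "\<dots> = cover_content (E k) + (cover_content (E (Suc k)) + (\<Sum>j\<le>Suc k. \<epsilon> j))"
      by (simp add: ac_simps)
    finally show ?case
      using fin[of k] by (simp add: add.commute[of _ "cover_content (E k)"] ennreal_add_left_cancel_le less_top[symmetric])
  qed
  have \<epsilon>sum: "(\<Sum>j\<le>k. \<epsilon> j) \<le> ennreal e" for k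
  proof -
    have "(\<Sum>j\<le>k. \<epsilon> j) \<le> (\<Sum>j. \<epsilon> j)" by (rule sum_le_suminf) (auto intro: summableI)
    also have "(\<Sum>j. \<epsilon> j) = ennreal e"
      unfolding \<epsilon>_def using sums_mult[OF power_half_series, of e] \<open>0 < e\<close>
      by (intro suminf_ennreal_eq) auto
    finally show ?thesis .
  qed
  \<comment> \<open>The lower limit of the families \<open>\<D> k\<close>; the inner intersections
    increase with \<open>k\<close>.\<close>
  define \<L> where "\<L> = (\<Union>k. \<Inter>j\<in>{k..}. \<D> j)"
  have cov: "(\<Union>k. E k) \<subseteq> \<Union>\<L>"
  proof
    fix x assume "x \<in> (\<Union>k. E k)"
    then obtain k where "x \<in> E k" by blast
    then obtain Q0 where Q0: "Q0 \<in> \<D> k" "x \<in> Q0" using Dcov[of k] by blast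
    define \<S> where "\<S> = (\<Union>k. \<D> k)"
    have SQ: "\<S> \<subseteq> \<Q>" using DQ by (auto simp: \<S>_def)
    \<comment> \<open>\<open>Q\<close> is maximal among all cells that ever occur. Once it has
      entered, merging could discard it only in favour of a strictly larger cell, and there is
      none.\<close>
    obtain Q where Q: "Q \<in> maximals \<S>" "Q0 \<subseteq> Q"
      using maximals_above[OF SQ _ Q0(2)] Q0(1) by (auto simp: \<S>_def)
    have "x \<in> Q" using Q Q0 by auto
    obtain m where "Q \<in> \<D> m" using Q by (auto simp: \<S>_def maximals_def)
    have "Q \<in> \<D> j" if "m \<le> j" for j
      using that
    proof (induction j rule: dec_induct)
      case (step j)
      have "\<D> j \<union> \<C> (Suc j) \<subseteq> \<Q>" using DQ \<C>(1) by auto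
      then obtain R where R: "R \<in> \<D> (Suc j)" "Q \<subseteq> R"
        using maximals_above[OF _ UnI1 \<open>x \<in> Q\<close>] step.IH unfolding DS by blast
      then have "R = Q" using Q(1) by (auto simp: maximals_def \<S>_def)
      then show ?case using R by simp
    qed fact
    then have "Q \<in> \<L>" unfolding \<L>_def by auto
    then show "x \<in> \<Union>\<L>" using \<open>x \<in> Q\<close> by blast
  qed
  have "cover_content (\<Union>k. E k) \<le> emeasure \<mu> \<L>"
    by (rule cover_content_le[OF _ cov]) (use DQ in \<open>auto simp: \<L>_def dest: spec\<close>)
  also have "\<dots> = (SUP k. emeasure \<mu> (\<Inter>j\<in>{k..}. \<D> j))"
    unfolding \<L>_def by (rule SUP_emeasure_incseq[symmetric]) (auto simp: sets_eq incseq_def)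
  also have "\<dots> \<le> c + ennreal e"
  proof (rule SUP_least)
    fix k
    have "emeasure \<mu> (\<Inter>j\<in>{k..}. \<D> j) \<le> emeasure \<mu> (\<D> k)"
      by (rule emeasure_mono) (auto simp: sets_eq)
    also have "\<dots> \<le> c + ennreal e"
      by (rule order_trans[OF Dle]) (intro add_mono bound \<epsilon>sum)
    finally show "emeasure \<mu> (\<Inter>j\<in>{k..}. \<D> j) \<le> c + ennreal e" .
  qed
  finally show "cover_content (\<Union>k. E k) \<le> c + ennreal e" .
qed

end

section \<open>Dyadic content and Hausdorff measure\<close>

definition power_measure :: "nat \<Rightarrow> 'a::metric_space set measure" where
  "power_measure n = density (count_space UNIV) (\<lambda>Q. ennreal (diameter Q ^ n))"

lemma sets_power_measure: "sets (power_measure n) = UNIV"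
  by (simp add: power_measure_def)

lemma emeasure_power_measure:
  "emeasure (power_measure n) \<C> = (\<integral>\<^sup>+Q. ennreal (diameter Q ^ n) \<partial>count_space \<C>)"
  unfolding power_measure_def
  by (subst emeasure_density) (auto simp: nn_integral_count_space_indicator)

text \<open>Half-open cubes of side \<open>1 / 2 ^ k\<close>: rounding down assigns to each point
  exactly one cube per level. Levels are natural numbers, so a cube has only finitely many larger
  ones around it.\<close>

definition dyadic_cube :: "nat \<Rightarrow> int ^ 'd \<Rightarrow> (real ^ 'd) set" where
  "dyadic_cube k z = {y. \<forall>i. \<lfloor>2 ^ k * y $ i\<rfloor> = z $ i}"

definition dyadic_cubes :: "(real ^ 'd) set set" where
  "dyadic_cubes = range (\<lambda>(k, z). dyadic_cube k z)"

lemma countable_dyadic_cubes: "countable (dyadic_cubes :: (real ^ 'd) set set)"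
  unfolding dyadic_cubes_def by (rule countable_image) simp

lemma mem_dyadic_cube_iff: "y \<in> dyadic_cube k z \<longleftrightarrow> z = (\<chi> i. \<lfloor>2 ^ k * y $ i\<rfloor>)"
  by (auto simp: dyadic_cube_def vec_eq_iff)

lemma dyadic_cubes_cases:
  assumes "Q \<in> dyadic_cubes"
  obtains k z where "Q = dyadic_cube k z"
  using assms by (auto simp: dyadic_cubes_def)

text \<open>Rounding at the coarse level factors through rounding at the fine level, by integer
  division by \<open>2 ^ (k - j)\<close>.\<close>

lemma dyadic_cube_subset:
  assumes "j \<le> k" "x \<in> dyadic_cube k z" "x \<in> dyadic_cube j w"
  shows "dyadic_cube k z \<subseteq> dyadic_cube j w"
proof -
  have *: "\<lfloor>2 ^ j * y $ i\<rfloor> = \<lfloor>2 ^ k * y $ i\<rfloor> div 2 ^ (k - j)" for y :: "real ^ 'd" and i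
  proof -
    have "2 ^ j * y $ i = 2 ^ k * y $ i / real_of_int (2 ^ (k - j))"
      using \<open>j \<le> k\<close> power_add[of "2::real" j "k - j"] by simp
    then show ?thesis by (simp only: floor_divide_real_eq_div zero_le_power zero_le_numeral)
  qed
  show ?thesis
  proof
    fix y assume "y \<in> dyadic_cube k z"
    then have "\<lfloor>2 ^ j * y $ i\<rfloor> = \<lfloor>2 ^ j * x $ i\<rfloor>" for i
      using assms(2) by (simp add: * dyadic_cube_def)
    then show "y \<in> dyadic_cube j w" using assms(3) by (simp add: dyadic_cube_def)
  qed
qed

text \<open>The distance is bounded by the sum of the coordinate differences. The resulting factor
  \<open>CARD('d)\<close> is not sharp, but constants do not affect null sets.\<close>

lemma dyadic_cube_dist_le:
  fixes x y :: "real ^ 'd"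
  assumes "x \<in> dyadic_cube k z" "y \<in> dyadic_cube k z"
  shows "dist x y \<le> real CARD('d) / 2 ^ k"
proof -
  have "\<bar>(x - y) $ i\<bar> \<le> 1 / 2 ^ k" for i
  proof -
    have "\<lfloor>2 ^ k * x $ i\<rfloor> = \<lfloor>2 ^ k * y $ i\<rfloor>" using assms by (simp add: dyadic_cube_def)
    then have "\<bar>2 ^ k * x $ i - 2 ^ k * y $ i\<bar> \<le> 1" by linarith
    then have "2 ^ k * \<bar>x $ i - y $ i\<bar> \<le> 1"
      by (simp add: right_diff_distrib[symmetric] abs_mult)
    then show ?thesis by (simp add: field_simps)
  qed
  then have "(\<Sum>i\<in>UNIV. \<bar>(x - y) $ i\<bar>) \<le> (\<Sum>i\<in>(UNIV::'d set). 1 / 2 ^ k)" by (intro sum_mono)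
  then show ?thesis using norm_le_l1_cart[of "x - y"] by (simp add: dist_norm)
qed

lemma diameter_dyadic_cube_le:
  "diameter (dyadic_cube k z :: (real ^ 'd) set) \<le> real CARD('d) / 2 ^ k"
  by (rule diameter_le) (use dyadic_cube_dist_le in \<open>auto simp: dist_norm\<close>)

lemma bounded_dyadic_cube: "bounded (dyadic_cube k z)"
  unfolding bounded_two_points using dyadic_cube_dist_le by blast

interpretation dyadic: laminar_family "dyadic_cubes :: (real ^ 'd) set set" "power_measure n" for n
proof
  fix Q R :: "(real ^ 'd) set" and x
  assume Q: "Q \<in> dyadic_cubes" and x: "x \<in> Q"
  obtain k z where k: "Q = dyadic_cube k z" using Q by (rule dyadic_cubes_cases)
  show "Q \<subseteq> R \<or> R \<subseteq> Q" if R: "R \<in> dyadic_cubes" and "x \<in> R"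
  proof -
    obtain j w where j: "R = dyadic_cube j w" using R by (rule dyadic_cubes_cases)
    show ?thesis using dyadic_cube_subset[of j k x z w] dyadic_cube_subset[of k j x w z]
        x \<open>x \<in> R\<close> unfolding j k by linarith
  qed
  \<comment> \<open>A cube containing \<open>Q\<close> contains \<open>x\<close>, hence is
    determined by its level. If that level is finer than \<open>k\<close>, the cube also lies in
    \<open>Q\<close> and so equals it.\<close>
  have "{R \<in> dyadic_cubes. Q \<subseteq> R} \<subseteq> (\<lambda>j. dyadic_cube j (\<chi> i. \<lfloor>2 ^ j * x $ i\<rfloor>)) ` {..k}"
  proof clarify
    fix R :: "(real ^ 'd) set" assume R: "R \<in> dyadic_cubes" "Q \<subseteq> R"
    then obtain j w where j: "R = dyadic_cube j w" using dyadic_cubes_cases by blast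
    have "x \<in> R" using R x by blast
    show "R \<in> (\<lambda>j. dyadic_cube j (\<chi> i. \<lfloor>2 ^ j * x $ i\<rfloor>)) ` {..k}"
    proof (cases "j \<le> k")
      case True
      moreover have "w = (\<chi> i. \<lfloor>2 ^ j * x $ i\<rfloor>)" using \<open>x \<in> R\<close> unfolding j mem_dyadic_cube_iff .
      ultimately show ?thesis using j by (intro image_eqI[of _ _ j]) auto
    next
      case False
      then have "R \<subseteq> Q" using dyadic_cube_subset[of k j x w z] \<open>x \<in> R\<close> x unfolding j k by simp
      then have "R = dyadic_cube k z" using R k by simp
      moreover have "z = (\<chi> i. \<lfloor>2 ^ k * x $ i\<rfloor>)" using x unfolding k mem_dyadic_cube_iff .
      ultimately show ?thesis by (intro image_eqI[of _ _ k]) auto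
    qed
  qed
  then show "finite {R \<in> dyadic_cubes. Q \<subseteq> R}" by (rule finite_subset) simp
qed (simp add: sets_power_measure)

abbreviation dyadic_content :: "nat \<Rightarrow> (real ^ 'd) set \<Rightarrow> ennreal" where
  "dyadic_content \<equiv> dyadic.cover_content"

section \<open>Comparison of dyadic content and Hausdorff measure\<close>

text \<open>The countable family is enumerated and the sequence padded with empty sets, which cost
  nothing; \<open>0 \<le> \<delta>\<close> admits them as members of diameter 0.\<close>

lemma hausdorff_approx_le_nn_integral:
  assumes "countable \<C>" "A \<subseteq> \<Union>\<C>" "\<And>Q. Q \<in> \<C> \<Longrightarrow> bounded Q \<and> diameter Q \<le> \<delta>" "0 \<le> \<delta>"
  shows "hausdorff_approx h \<delta> A \<le> (\<integral>\<^sup>+Q. h (diameter Q) \<partial>count_space \<C>)"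
proof -
  define g where "g = to_nat_on \<C>"
  have bij: "bij_betw g \<C> (g ` \<C>)"
    unfolding g_def using assms(1) by (simp add: bij_betw_def inj_on_to_nat_on)
  define C where "C j = (if j \<in> g ` \<C> then inv_into \<C> g j else {})" for j
  have Cg: "C (g Q) = Q" if "Q \<in> \<C>" for Q
    using that bij by (simp add: C_def bij_betw_inv_into_left)
  have C0: "C j = {} \<or> C j \<in> \<C>" for j
    by (simp add: C_def inv_into_into)
  have "A \<subseteq> (\<Union>j. C j)"
    using assms(2) Cg by blast
  moreover have "bounded (C j) \<and> diameter (C j) \<le> \<delta>" for j
    using C0[of j] assms(3,4) by (auto simp: diameter_empty)
  ultimately have "hausdorff_approx h \<delta> A \<le> (\<Sum>j. if C j = {} then 0 else h (diameter (C j)))"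
    unfolding hausdorff_approx_def by (intro INF_lower) auto
  also have "\<dots> = (\<integral>\<^sup>+j. (if C j = {} then 0 else h (diameter (C j))) \<partial>count_space UNIV)"
    by (simp add: nn_integral_count_space_nat)
  also have "\<dots> \<le> (\<integral>\<^sup>+j. h (diameter (C j)) * indicator (g ` \<C>) j \<partial>count_space UNIV)"
    by (intro nn_integral_mono) (auto simp: C_def indicator_def)
  also have "\<dots> = (\<integral>\<^sup>+j. h (diameter (C j)) \<partial>count_space (g ` \<C>))"
    by (simp add: nn_integral_count_space_indicator)
  also have "\<dots> = (\<integral>\<^sup>+Q. h (diameter (C (g Q))) \<partial>count_space \<C>)"
    by (rule nn_integral_bij_count_space[OF bij, symmetric])
  also have "\<dots> = (\<integral>\<^sup>+Q. h (diameter Q) \<partial>count_space \<C>)"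
    by (intro nn_integral_cong) (simp add: Cg)
  finally show ?thesis .
qed

lemma hausdorff_measure_eq_0I:
  assumes "\<And>\<delta> e. \<lbrakk>0 < \<delta>; 0 < e\<rbrakk> \<Longrightarrow> hausdorff_approx h \<delta> A \<le> ennreal e"
  shows "hausdorff_measure h A = 0"
proof -
  have "hausdorff_approx h \<delta> A \<le> 0" if "0 < \<delta>" for \<delta>
    by (rule ennreal_le_epsilon) (use assms that in simp)
  then show ?thesis unfolding hausdorff_measure_def by (simp add: SUP_eq_iff bot_ennreal)
qed

lemma hausdorff_approx_eq_0:
  assumes "hausdorff_measure h A = 0" "0 < \<delta>"
  shows "hausdorff_approx h \<delta> A = 0"
proof -
  have "hausdorff_approx h \<delta> A \<le> hausdorff_measure h A"
    unfolding hausdorff_measure_def using assms(2) by (intro SUP_upper) auto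
  then show ?thesis using assms by simp
qed

text \<open>Each cube weighs its diameter to the power \<open>n\<close>, so a cover of total weight
  below \<open>\<delta> ^ n\<close> automatically consists of cubes of diameter at most
  \<open>\<delta>\<close>. Small content therefore controls the approximants at every scale.\<close>

lemma hausdorff_measure_null_of_dyadic_content:
  fixes A :: "(real ^ 'd) set"
  assumes "dyadic_content n A = 0" "0 < n"
  shows "hausdorff_measure (\<lambda>t. ennreal (t ^ n)) A = 0"
proof (rule hausdorff_measure_eq_0I)
  fix \<delta> e :: real assume "0 < \<delta>" "0 < e"
  then have "dyadic_content n A < ennreal (min e (\<delta> ^ n))" using assms by simp
  then obtain \<C> where \<C>: "\<C> \<subseteq> dyadic_cubes" "A \<subseteq> \<Union>\<C>"
    "emeasure (power_measure n) \<C> < ennreal (min e (\<delta> ^ n))"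
    using dyadic.cover_content_lessD by blast
  have cnt: "countable \<C>" using \<C>(1) countable_dyadic_cubes countable_subset by blast
  have "bounded Q \<and> diameter Q \<le> \<delta>" if "Q \<in> \<C>" for Q
  proof
    show b: "bounded Q" using that \<C>(1) bounded_dyadic_cube by (auto elim: dyadic_cubes_cases)
    have "ennreal (diameter Q ^ n) = emeasure (power_measure n) {Q}"
      unfolding emeasure_power_measure by (simp add: nn_integral_count_space_finite)
    also have "\<dots> \<le> emeasure (power_measure n) \<C>"
      using that by (intro emeasure_mono) (auto simp: sets_power_measure)
    also have "\<dots> \<le> ennreal (\<delta> ^ n)"
      using \<C>(3) by (rule order_trans[OF less_imp_le]) (simp add: ennreal_leI)
    finally have "diameter Q ^ n \<le> \<delta> ^ n" using \<open>0 < \<delta>\<close> by simp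
    then show "diameter Q \<le> \<delta>" using \<open>0 < \<delta>\<close> \<open>0 < n\<close> power_mono_iff diameter_ge_0[OF b]
      by (metis less_imp_le)
  qed
  then have "hausdorff_approx (\<lambda>t. ennreal (t ^ n)) \<delta> A \<le> emeasure (power_measure n) \<C>"
    unfolding emeasure_power_measure using \<C> cnt \<open>0 < \<delta>\<close>
    by (intro hausdorff_approx_le_nn_integral) auto
  also have "\<dots> \<le> ennreal e"
    using \<C>(3) by (rule order_trans[OF less_imp_le]) (simp add: ennreal_leI)
  finally show "hausdorff_approx (\<lambda>t. ennreal (t ^ n)) \<delta> A \<le> ennreal e" .
qed

lemma finite_unit_int_vecs: "finite {w :: int ^ 'd. \<forall>i. \<bar>w $ i\<bar> \<le> 1}"
proof -
  have "{w :: int ^ 'd. \<forall>i. \<bar>w $ i\<bar> \<le> 1} \<subseteq> vec_lambda ` (PiE UNIV (\<lambda>_. {-1..1}))"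
  proof
    fix w :: "int ^ 'd" assume "w \<in> {w. \<forall>i. \<bar>w $ i\<bar> \<le> 1}"
    then have "vec_nth w \<in> PiE UNIV (\<lambda>_. {-1..1})" by (auto simp: abs_le_iff minus_le_iff)
    then show "w \<in> vec_lambda ` (PiE UNIV (\<lambda>_. {-1..1}))" by (metis image_eqI vec_lambda_eta vec_nth_inverse)
  qed
  then show ?thesis by (rule finite_subset) (intro finite_imageI finite_PiE, auto)
qed

text \<open>The first factor counts a grid cube together with its neighbours; the second comes from
  their diameters, at most \<open>2 * CARD('d) * r\<close> when a set of radius \<open>r\<close> is
  covered.\<close>

definition dyadic_const :: "'d::finite itself \<Rightarrow> nat \<Rightarrow> real" where
  "dyadic_const _ n = real (card {w :: int ^ 'd. \<forall>i. \<bar>w $ i\<bar> \<le> 1}) * (2 * real CARD('d)) ^ n"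

text \<open>Take a level with side between \<open>r\<close> and \<open>2 * r\<close>. Rounded
  coordinates of points within \<open>r\<close> of \<open>x\<close> then differ from those of
  \<open>x\<close> by at most 1, so the cube of \<open>x\<close> and its neighbours suffice.\<close>

lemma dyadic_content_le_radius:
  fixes C :: "(real ^ 'd) set"
  assumes "\<And>y. y \<in> C \<Longrightarrow> dist x y \<le> r" "0 < r" "r \<le> 1"
  shows "dyadic_content n C \<le> ennreal (dyadic_const TYPE('d) n * r ^ n)"
proof -
  \<comment> \<open>The first exponent with \<open>(1/2) ^ m < r\<close>. It is positive because
    \<open>r \<le> 1\<close>, and its predecessor \<open>k\<close> is the level used.\<close>
  define m where "m = (LEAST m. (1/2) ^ m < r)"
  have m: "(1/2) ^ m < r"
    unfolding m_def by (rule LeastI_ex) (use real_arch_pow_inv[of r "1/2"] \<open>0 < r\<close> in simp)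
  with \<open>r \<le> 1\<close> obtain k where k: "m = Suc k" by (cases m) auto
  have "\<not> (1/2) ^ k < r"
    using not_less_Least[of k "\<lambda>m. (1/2) ^ m < r"] k unfolding m_def by simp
  then have rk: "r * 2 ^ k \<le> 1" by (simp add: power_divide field_simps)
  have kr: "1 / 2 ^ k \<le> 2 * r" using m unfolding k by (simp add: power_divide field_simps)
  define W where "W = {w :: int ^ 'd. \<forall>i. \<bar>w $ i\<bar> \<le> 1}"
  define a where "a = (\<chi> i. \<lfloor>2 ^ k * x $ i\<rfloor>)"
  define \<C> where "\<C> = (\<lambda>w. dyadic_cube k (a + w)) ` W"
  have finW: "finite W" unfolding W_def by (rule finite_unit_int_vecs)
  have "C \<subseteq> \<Union>\<C>"
  proof
    fix y assume "y \<in> C"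
    define b where "b = (\<chi> i. \<lfloor>2 ^ k * y $ i\<rfloor>)"
    have "\<bar>b $ i - a $ i\<bar> \<le> 1" for i
    proof -
      have "\<bar>x $ i - y $ i\<bar> \<le> r"
        using assms(1)[OF \<open>y \<in> C\<close>] component_le_norm_cart[of "x - y" i] by (simp add: dist_norm)
      then have "\<bar>x $ i - y $ i\<bar> * 2 ^ k \<le> 1"
        using rk by (meson mult_right_mono order_trans zero_le_numeral zero_le_power)
      moreover have "\<bar>2 ^ k * x $ i - 2 ^ k * y $ i\<bar> = \<bar>x $ i - y $ i\<bar> * 2 ^ k"
        by (simp add: abs_mult flip: right_diff_distrib)
      ultimately have "\<bar>2 ^ k * x $ i - 2 ^ k * y $ i\<bar> \<le> 1" by simp
      then show ?thesis unfolding a_def b_def by simp linarith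
    qed
    then have "b - a \<in> W" by (simp add: W_def)
    moreover have "y \<in> dyadic_cube k (a + (b - a))" by (simp add: mem_dyadic_cube_iff b_def)
    ultimately show "y \<in> \<Union>\<C>" unfolding \<C>_def by blast
  qed
  then have "dyadic_content n C \<le> emeasure (power_measure n) \<C>"
    by (intro dyadic.cover_content_le) (auto simp: \<C>_def dyadic_cubes_def)
  also have "\<dots> = (\<Sum>Q\<in>\<C>. ennreal (diameter Q ^ n))"
    unfolding emeasure_power_measure by (simp add: nn_integral_count_space_finite \<C>_def finW)
  also have "\<dots> \<le> (\<Sum>Q\<in>\<C>. ennreal ((2 * real CARD('d) * r) ^ n))"
  proof (intro sum_mono ennreal_leI power_mono)
    fix Q assume "Q \<in> \<C>"
    then obtain z where z: "Q = dyadic_cube k z" by (auto simp: \<C>_def)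
    have "diameter Q \<le> real CARD('d) / 2 ^ k" unfolding z by (rule diameter_dyadic_cube_le)
    also have "\<dots> \<le> real CARD('d) * (2 * r)"
      using mult_left_mono[OF kr, of "real CARD('d)"] by simp
    finally show "diameter Q \<le> 2 * real CARD('d) * r" by (simp add: ac_simps)
    show "0 \<le> diameter Q" unfolding z by (rule diameter_ge_0[OF bounded_dyadic_cube])
  qed
  also have "\<dots> = ennreal (real (card \<C>) * (2 * real CARD('d) * r) ^ n)"
    using \<open>0 < r\<close> by (simp add: ennreal_mult ennreal_of_nat_eq_real_of_nat)
  also have "\<dots> \<le> ennreal (real (card W) * (2 * real CARD('d) * r) ^ n)"
    using \<open>0 < r\<close> card_image_le[OF finW] by (intro ennreal_leI mult_right_mono) (auto simp: \<C>_def)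
  finally show ?thesis by (simp add: dyadic_const_def W_def power_mult_distrib ac_simps)
qed

text \<open>Radii \<open>r\<close> tend to the diameter from above, because the radius bound
  requires \<open>0 < r\<close> and one-point sets have diameter 0.\<close>

lemma dyadic_content_le_diameter:
  fixes C :: "(real ^ 'd) set"
  assumes "C \<noteq> {}" "bounded C" "diameter C < 1"
  shows "dyadic_content n C \<le> ennreal (dyadic_const TYPE('d) n * diameter C ^ n)"
proof -
  obtain x where "x \<in> C" using assms by blast
  have "0 \<le> diameter C" using assms by (simp add: diameter_ge_0)
  have "((\<lambda>r. ennreal (dyadic_const TYPE('d) n * r ^ n))
      \<longlongrightarrow> ennreal (dyadic_const TYPE('d) n * diameter C ^ n)) (at_right (diameter C))"
    by (intro tendsto_intros)
  moreover have "\<forall>\<^sub>F r in at_right (diameter C).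
      dyadic_content n C \<le> ennreal (dyadic_const TYPE('d) n * r ^ n)"
    unfolding eventually_at_right[OF assms(3)]
  proof (intro exI[of _ 1] conjI allI impI assms)
    fix r assume "diameter C < r" "r < 1"
    then show "dyadic_content n C \<le> ennreal (dyadic_const TYPE('d) n * r ^ n)"
      using \<open>0 \<le> diameter C\<close> diameter_bounded_bound[OF assms(2) \<open>x \<in> C\<close>]
      by (intro dyadic_content_le_radius[of C x]) force+
  qed
  ultimately show ?thesis by (rule tendsto_lowerbound) simp
qed

text \<open>Each member of a Hausdorff cover is exchanged for dyadic cubes at the cost of a constant
  factor; \<open>\<delta> < 1\<close> puts all members in the range of the diameter bound.\<close>

lemma dyadic_content_le_hausdorff_approx:
  fixes A :: "(real ^ 'd) set"
  assumes "hausdorff_approx (\<lambda>t. ennreal (t ^ n)) \<delta> A < e" "\<delta> < 1"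
  shows "dyadic_content n A \<le> ennreal (dyadic_const TYPE('d) n) * e"
proof -
  let ?K = "dyadic_const TYPE('d) n"
  have "0 \<le> ?K" by (simp add: dyadic_const_def)
  obtain C :: "nat \<Rightarrow> (real ^ 'd) set" where C: "A \<subseteq> (\<Union>j. C j)"
    "\<And>j. bounded (C j) \<and> diameter (C j) \<le> \<delta>"
    "(\<Sum>j. if C j = {} then 0 else ennreal (diameter (C j) ^ n)) < e"
    using assms(1) unfolding hausdorff_approx_def by (auto simp: INF_less_iff)
  have empty: "dyadic_content n ({} :: (real ^ 'd) set) = 0"
    using dyadic.cover_content_le[of "{}" "{}" n] by simp
  have "dyadic_content n A \<le> dyadic_content n (\<Union>j. C j)" by (rule dyadic.cover_content_mono[OF C(1)])
  also have "\<dots> \<le> (\<Sum>j. dyadic_content n (C j))" by (rule dyadic.cover_content_UN_le)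
  also have "\<dots> \<le> (\<Sum>j. ennreal ?K * (if C j = {} then 0 else ennreal (diameter (C j) ^ n)))"
  proof (intro suminf_le summableI)
    fix j
    have "diameter (C j) < 1" using C(2)[of j] assms(2) by simp
    then show "dyadic_content n (C j) \<le> ennreal ?K * (if C j = {} then 0 else ennreal (diameter (C j) ^ n))"
      using dyadic_content_le_diameter[of "C j" n] C(2)[of j] \<open>0 \<le> ?K\<close>
      by (auto simp: empty ennreal_mult diameter_ge_0)
  qed
  also have "\<dots> = ennreal ?K * (\<Sum>j. if C j = {} then 0 else ennreal (diameter (C j) ^ n))"
    by simp
  also have "\<dots> \<le> ennreal ?K * e" using C(3) by (intro mult_left_mono) auto
  finally show ?thesis .
qed

text \<open>Right-continuity of the gauge pays for thickening the members of a cover to open sets.\<close>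
lemma hausdorff_null_open_hull:
  fixes N :: "'a::metric_space set"
  assumes h: "gauge_function h" and null: "hausdorff_measure h N = 0" and "0 < e"
  obtains U where "open U" "N \<subseteq> U" "hausdorff_approx h e U < ennreal e"
proof -
  \<comment> \<open>Diameters up to \<open>e/3\<close> leave room for thickening by at most
    \<open>e/3\<close> at both ends, and a sum below \<open>e/2\<close> leaves \<open>e/2\<close>
    for the growth of the gauge.\<close>
  have "hausdorff_approx h (e/3) N < ennreal (e/2)"
    using hausdorff_approx_eq_0[OF null, of "e/3"] \<open>0 < e\<close> by simp
  then obtain C :: "nat \<Rightarrow> 'a set" where C: "N \<subseteq> (\<Union>j. C j)"
    "\<And>j. bounded (C j) \<and> diameter (C j) \<le> e/3"
    "(\<Sum>j. if C j = {} then 0 else h (diameter (C j))) < ennreal (e/2)"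
    unfolding hausdorff_approx_def by (auto simp: INF_less_iff)
  define g where "g j = (if C j = {} then 0 else h (diameter (C j)))" for j
  define \<epsilon> where "\<epsilon> j = ennreal (e/2 * (1/2) ^ Suc j)" for j
  have d0: "0 \<le> diameter (C j)" for j using C(2) by (simp add: diameter_ge_0)
  have "\<exists>\<eta>>0. \<eta> \<le> e/3 \<and> (C j \<noteq> {} \<longrightarrow> h (diameter (C j) + 2 * \<eta>) \<le> g j + \<epsilon> j)" for j
  proof (cases "C j = {}")
    case False
    let ?t = "diameter (C j)"
    \<comment> \<open>A gauge may take the value infinity. The finite sum makes this term finite, so
      that adding \<open>\<epsilon> j\<close> is a strict increase.\<close>
    have "g j \<le> (\<Sum>j. g j)" using sum_le_suminf[of g "{j}"] by (auto simp: summableI)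
    also have "\<dots> < top" using C(3) unfolding g_def by (metis less_trans ennreal_less_top)
    finally have "h ?t < h ?t + \<epsilon> j"
      using False \<open>0 < e\<close> by (simp add: g_def \<epsilon>_def less_top[symmetric] ennreal_less_zero_iff)
    moreover have "(h \<longlongrightarrow> h ?t) (at_right ?t)" using h d0 by (auto simp: gauge_function_def)
    ultimately have "\<forall>\<^sub>F s in at_right ?t. h s < h ?t + \<epsilon> j" by (rule order_tendstoD(2)[rotated])
    then obtain b where b: "b > ?t" "\<And>s. \<lbrakk>?t < s; s < b\<rbrakk> \<Longrightarrow> h s < h ?t + \<epsilon> j"
      unfolding eventually_at_right_field by blast
    define \<eta> where "\<eta> = min (e/3) ((b - ?t)/3)"
    have "0 < \<eta>" "\<eta> \<le> e/3" "?t + 2 * \<eta> < b" using b(1) \<open>0 < e\<close> by (auto simp: \<eta>_def min_def field_simps)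
    then show ?thesis using b(2)[of "?t + 2 * \<eta>"] False by (intro exI[of _ \<eta>]) (auto simp: g_def)
  qed (use \<open>0 < e\<close> in \<open>auto intro!: exI[of _ "e/3"]\<close>)
  then obtain \<eta> where \<eta>: "\<And>j. 0 < \<eta> j" "\<And>j. \<eta> j \<le> e/3"
    "\<And>j. C j \<noteq> {} \<Longrightarrow> h (diameter (C j) + 2 * \<eta> j) \<le> g j + \<epsilon> j" by metis
  define V where "V j = (\<Union>x\<in>C j. ball x (\<eta> j))" for j
  have Vdist: "dist x y \<le> diameter (C j) + 2 * \<eta> j" if "x \<in> V j" "y \<in> V j" for x y j
  proof -
    from that obtain a b where ab: "a \<in> C j" "b \<in> C j" "dist a x < \<eta> j" "dist b y < \<eta> j"
      unfolding V_def mem_ball UN_iff by blast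
    have "dist a b \<le> diameter (C j)" using C(2) ab by (simp add: diameter_bounded_bound)
    then show ?thesis
      using ab dist_triangle[of x y a] dist_triangle[of a y b] by (simp add: dist_commute)
  qed
  have Vbd: "bounded (V j)" for j unfolding bounded_two_points using Vdist by blast
  have Vdiam: "diameter (V j) \<le> diameter (C j) + 2 * \<eta> j" for j
  proof (cases "V j = {}")
    case False
    then have "diameter (V j) = (SUP (x, y)\<in>V j \<times> V j. dist x y)" by (simp add: diameter_def)
    also have "\<dots> \<le> diameter (C j) + 2 * \<eta> j"
      using False by (intro cSUP_least) (auto intro: Vdist)
    finally show ?thesis .
  qed (use d0[of j] \<eta>(1)[of j] in simp)
  have "hausdorff_approx h e (\<Union>j. V j) \<le> (\<Sum>j. if V j = {} then 0 else h (diameter (V j)))"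
    unfolding hausdorff_approx_def
  proof (intro INF_lower CollectI conjI allI order_refl Vbd)
    show "diameter (V j) \<le> e" for j using Vdiam[of j] C(2)[of j] \<eta>(2)[of j] by linarith
  qed
  also have "\<dots> \<le> (\<Sum>j. g j + \<epsilon> j)"
  proof (intro suminf_le summableI)
    fix j
    show "(if V j = {} then 0 else h (diameter (V j))) \<le> g j + \<epsilon> j"
    proof (cases "V j = {}")
      case False
      then have "C j \<noteq> {}" by (auto simp: V_def)
      have "h (diameter (V j)) \<le> h (diameter (C j) + 2 * \<eta> j)"
        using h Vdiam[of j] d0[of j] \<eta>(1)[of j] diameter_ge_0[OF Vbd[of j]]
        unfolding gauge_function_def by (auto intro!: mono_onD[of "{0..}" h])
      then show ?thesis using False \<eta>(3)[OF \<open>C j \<noteq> {}\<close>] by simp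
    qed simp
  qed
  also have "\<dots> = (\<Sum>j. g j) + (\<Sum>j. \<epsilon> j)" by (simp add: suminf_add summableI)
  also have "(\<Sum>j. \<epsilon> j) = ennreal (e/2)"
    unfolding \<epsilon>_def using sums_mult[OF power_half_series, of "e/2"] \<open>0 < e\<close>
    by (intro suminf_ennreal_eq) auto
  also have "(\<Sum>j. g j) + ennreal (e/2) < ennreal (e/2) + ennreal (e/2)"
    using C(3) unfolding g_def by (simp add: ennreal_add_left_cancel_less add.commute)
  also have "\<dots> = ennreal e" using \<open>0 < e\<close> by (simp flip: ennreal_plus)
  finally have "hausdorff_approx h e (\<Union>j. V j) < ennreal e" .
  moreover have "open (\<Union>j. V j)" by (auto simp: V_def)
  moreover have "C j \<subseteq> V j" for j using \<eta>(1)[of j] by (auto simp: V_def)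
  then have "N \<subseteq> (\<Union>j. V j)" by (intro order_trans[OF C(1)] UN_mono) auto
  ultimately show thesis by (intro that)
qed

lemma gauge_function_power: "gauge_function (\<lambda>t. ennreal (t ^ n))"
  unfolding gauge_function_def
  by (auto intro!: mono_onI ennreal_leI power_mono tendsto_intros)

lemma hausdorff_null_open_hull_dyadic:
  fixes A :: "(real ^ 'd) set"
  assumes null: "hausdorff_measure (\<lambda>t. ennreal (t ^ n)) A = 0" and "0 < c"
  obtains V where "open V" "A \<subseteq> V" "dyadic_content n V \<le> ennreal c"
proof -
  let ?K = "dyadic_const TYPE('d) n"
  have "0 \<le> ?K" by (simp add: dyadic_const_def)
  \<comment> \<open>The bound \<open>1/2\<close> keeps the scale below 1; with \<open>?K + 1\<close>
    as denominator, \<open>0 \<le> ?K\<close> is enough.\<close>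
  define e where "e = min (1/2) (c / (?K + 1))"
  have "0 < e" "e < 1" using \<open>0 < c\<close> \<open>0 \<le> ?K\<close> by (auto simp: e_def)
  have "?K * e \<le> ?K * (c / (?K + 1))" using \<open>0 \<le> ?K\<close> by (intro mult_left_mono) (auto simp: e_def)
  also have "\<dots> \<le> c" using \<open>0 \<le> ?K\<close> \<open>0 < c\<close> by (simp add: field_simps)
  finally have "?K * e \<le> c" .
  obtain V where V: "open V" "A \<subseteq> V" "hausdorff_approx (\<lambda>t. ennreal (t ^ n)) e V < ennreal e"
    using hausdorff_null_open_hull[OF gauge_function_power null \<open>0 < e\<close>] by blast
  have "dyadic_content n V \<le> ennreal ?K * ennreal e"
    by (rule dyadic_content_le_hausdorff_approx[OF V(3) \<open>e < 1\<close>])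
  also have "\<dots> = ennreal (?K * e)" using \<open>0 \<le> ?K\<close> \<open>0 < e\<close> by (simp add: ennreal_mult)
  also have "\<dots> \<le> ennreal c" using \<open>?K * e \<le> c\<close> by (rule ennreal_leI)
  finally show thesis using V that by blast
qed

text \<open>Open hulls of arbitrarily small content contain \<open>A\<close>. Together with
  \<open>hausdorff_measure_null_of_dyadic_content\<close> this lets null sets be handled by either
  notion when \<open>n\<close> is positive.\<close>

lemma dyadic_content_null:
  fixes A :: "(real ^ 'd) set"
  assumes "hausdorff_measure (\<lambda>t. ennreal (t ^ n)) A = 0"
  shows "dyadic_content n A = 0"
proof -
  have "dyadic_content n A \<le> 0"
  proof (rule ennreal_le_epsilon)
    fix e :: real assume "0 < e"
    then obtain V where "A \<subseteq> V" "dyadic_content n V \<le> ennreal e"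
      using hausdorff_null_open_hull_dyadic[OF assms] by metis
    then show "dyadic_content n A \<le> 0 + ennreal e"
      using dyadic.cover_content_mono[of A V n] by simp
  qed
  then show ?thesis by simp
qed

lemma hausdorff_measure_countable:
  assumes "countable A" "h 0 = 0"
  shows "hausdorff_measure h A = 0"
proof (rule hausdorff_measure_eq_0I)
  fix \<delta> e :: real assume "0 < \<delta>" "0 < e"
  have "hausdorff_approx h \<delta> A \<le> (\<integral>\<^sup>+Q. h (diameter Q) \<partial>count_space ((\<lambda>x. {x}) ` A))"
    using assms \<open>0 < \<delta>\<close> by (intro hausdorff_approx_le_nn_integral) (auto simp: diameter_singleton)
  also have "\<dots> = (\<integral>\<^sup>+Q. 0 \<partial>count_space ((\<lambda>x. {x}) ` A))"
    by (intro nn_integral_cong) (auto simp: assms diameter_singleton)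
  finally show "hausdorff_approx h \<delta> A \<le> ennreal e" by simp
qed

lemma hausdorff_approx_antimono:
  assumes "A \<subseteq> B" "\<delta> \<le> \<delta>'"
  shows "hausdorff_approx h \<delta>' A \<le> hausdorff_approx h \<delta> B"
  unfolding hausdorff_approx_def
  by (rule INF_superset_mono) (use assms in \<open>auto intro: order_trans\<close>)

section \<open>Compact, perfect and totally disconnected subsets\<close>

text \<open>All basic open sets meeting \<open>K\<close> in a countable set are removed. An isolated
  point of the remainder would have a basic neighbourhood meeting \<open>K\<close> in that point and
  countably many removed ones, so it would have been removed too.\<close>

lemma perfect_kernel:
  fixes K :: "'a::{second_countable_topology, t2_space} set"
  assumes "compact K"
  obtains P where "P \<subseteq> K" "compact P" "countable (K - P)" "\<And>x. x \<in> P \<Longrightarrow> x islimpt P"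
proof -
  obtain \<B> :: "'a set set" where \<B>: "countable \<B>" "topological_basis \<B>"
    using ex_countable_basis by blast
  define \<U> where "\<U> = {U \<in> \<B>. countable (K \<inter> U)}"
  define P where "P = K - \<Union>\<U>"
  have "open (\<Union>\<U>)" using topological_basis_open[OF \<B>(2)] by (auto simp: \<U>_def)
  then have "compact P" unfolding P_def using assms by (rule compact_diff[rotated])
  have "countable \<U>" using \<B>(1) by (simp add: \<U>_def)
  then have "countable (\<Union>U\<in>\<U>. K \<inter> U)" by (intro countable_UN) (auto simp: \<U>_def)
  then have cnt: "countable (K - P)" by (rule countable_subset[rotated]) (auto simp: P_def)
  have "x islimpt P" if "x \<in> P" for x
  proof (rule ccontr)
    assume "\<not> x islimpt P"
    then obtain T where T: "x \<in> T" "open T" "\<And>y. y \<in> P \<Longrightarrow> y \<in> T \<Longrightarrow> y = x"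
      unfolding islimpt_def by blast
    obtain U where U: "U \<in> \<B>" "x \<in> U" "U \<subseteq> T" using topological_basisE[OF \<B>(2) T(2,1)] .
    have "K \<inter> U \<subseteq> insert x (K - P)" using T(3) U(3) by blast
    then have "countable (K \<inter> U)" by (rule countable_subset) (simp add: cnt)
    then show False using U that by (auto simp: \<U>_def P_def)
  qed
  then show thesis using \<open>compact P\<close> cnt by (intro that[of P]) (auto simp: P_def)
qed

section \<open>Total disconnectedness from avoided coordinate values\<close>

definition order_dense :: "real set \<Rightarrow> bool" where
  "order_dense D \<longleftrightarrow> (\<forall>a b. a < b \<longrightarrow> (\<exists>q\<in>D. a < q \<and> q < b))"

lemma order_dense_Rats_translate: "order_dense ((\<lambda>q. q + s) ` \<rat>)"
  unfolding order_dense_def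
proof (intro allI impI)
  fix a b :: real assume "a < b"
  then obtain q where "q \<in> \<rat>" "a - s < q" "q < b - s"
    using Rats_dense_in_real[of "a - s" "b - s"] by auto
  then show "\<exists>q\<in>(\<lambda>q. q + s) ` \<rat>. a < q \<and> q < b" by (intro bexI[of _ "q + s"]) auto
qed

text \<open>Each coordinate maps a component onto an interval. Two points differing in coordinate
  \<open>i\<close> would force this interval to contain a point of \<open>D i\<close>.\<close>

lemma totally_disconnected_if_coordinates_avoid:
  fixes K :: "(real ^ 'n) set"
  assumes D: "\<And>i. order_dense (D i)" and avoid: "\<And>i x. x \<in> K \<Longrightarrow> x $ i \<notin> D i"
  shows "totally_disconnected K"
  unfolding totally_disconnected_def
proof
  fix x assume "x \<in> K"
  let ?C = "connected_component_set K x"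
  have x: "x \<in> ?C" using \<open>x \<in> K\<close> by (simp add: connected_component_refl)
  have "y = x" if y: "y \<in> ?C" for y
  proof (rule ccontr)
    assume "y \<noteq> x"
    then obtain i where i: "y $ i \<noteq> x $ i" by (auto simp: vec_eq_iff)
    have con: "connected ((\<lambda>v. v $ i) ` ?C)"
      by (intro connected_continuous_image connected_connected_component continuous_intros)
    have "min (x $ i) (y $ i) < max (x $ i) (y $ i)" using i by (simp add: min_def max_def)
    then obtain q where q: "q \<in> D i" "min (x $ i) (y $ i) < q" "q < max (x $ i) (y $ i)"
      using D[of i] unfolding order_dense_def by blast
    have "q \<in> (\<lambda>v. v $ i) ` ?C"
      by (rule connectedD_interval[OF con, of "min (x $ i) (y $ i)" "max (x $ i) (y $ i)"])
        (use x y q in \<open>auto simp: min_def max_def\<close>)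
    then show False using avoid q(1) connected_component_subset[of K x] by blast
  qed
  then show "?C = {x}" using x by blast
qed

text \<open>Two disjoint dense translates of the rationals: the points whose \<open>i\<close>-th coordinate lies in
  the first avoid the second, so one of the two pieces keeps positive content.\<close>
lemma subset_avoiding_dense_coordinates:
  fixes f :: "real ^ 'n \<Rightarrow> real ^ 'd"
  assumes "dyadic_content n (f ` N) \<noteq> 0"
  obtains N' D where "N' \<subseteq> N" "dyadic_content n (f ` N') \<noteq> 0"
    "\<And>i. countable (D i)" "\<And>i. order_dense (D i)" "\<And>i x. x \<in> N' \<Longrightarrow> x $ i \<notin> D i"
proof -
  have "\<exists>s::real. s \<notin> \<rat>"
    using uncountable_UNIV_real countable_rat by (metis UNIV_eq_I)
  then obtain s :: real where s: "s \<notin> \<rat>" ..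
  \<comment> \<open>Coordinates are treated one at a time; shrinking the set preserves the
    conditions already achieved.\<close>
  have "\<exists>N' D. N' \<subseteq> N \<and> dyadic_content n (f ` N') \<noteq> 0 \<and>
      (\<forall>i\<in>I. countable (D i) \<and> order_dense (D i) \<and> (\<forall>x\<in>N'. x $ i \<notin> D i))" for I :: "'n set"
    using finite[of I]
  proof (induction I rule: finite_induct)
    case empty
    then show ?case using assms by auto
  next
    case (insert i I)
    then obtain N' D where N': "N' \<subseteq> N" "dyadic_content n (f ` N') \<noteq> 0"
      "\<forall>i\<in>I. countable (D i) \<and> order_dense (D i) \<and> (\<forall>x\<in>N'. x $ i \<notin> D i)" by blast
    define T where "T r = (\<lambda>q. q + r) ` (\<rat> :: real set)" for r
    define M where "M r = {x \<in> N'. x $ i \<notin> T r}" for r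
    have "T 0 \<inter> T s = {}"
    proof (rule ccontr)
      assume "T 0 \<inter> T s \<noteq> {}"
      then obtain p q where "p \<in> \<rat>" "q \<in> \<rat>" "p = q + s" by (auto simp: T_def)
      then show False using s Rats_diff[of p q] by simp
    qed
    then have "f ` N' = f ` M 0 \<union> f ` M s" by (auto simp: M_def)
    then have "\<exists>r. dyadic_content n (f ` M r) \<noteq> 0"
      using N'(2) dyadic.cover_content_Un_null by metis
    then obtain r where r: "dyadic_content n (f ` M r) \<noteq> 0" ..
    have "countable (T r)" "order_dense (T r)"
      using countable_rat order_dense_Rats_translate by (auto simp: T_def)
    then show ?case using N' r
      by (intro exI[of _ "M r"] exI[of _ "D(i := T r)"]) (auto simp: M_def)
  qed
  from this[of UNIV] obtain N' D where "N' \<subseteq> N" "dyadic_content n (f ` N') \<noteq> 0"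
    "\<forall>i. countable (D i) \<and> order_dense (D i) \<and> (\<forall>x\<in>N'. x $ i \<notin> D i)" by auto
  then show thesis by (intro that[of N' D]) auto
qed

text \<open>Choquet's capacitability argument for the \<open>G\<^sub>\<delta>\<close> set \<open>\<Inter>k. G k\<close>: continuity from below lets us
  shrink \<open>N\<close> into a compact part of each \<open>G k\<close> in turn without losing content, and open
  covers of \<open>f ` K\<close> catch a finite stage.\<close>
lemma compact_subset_positive_image:
  fixes f :: "'a::euclidean_space \<Rightarrow> real ^ 'd"
  assumes G: "\<And>k::nat. open (G k)" "\<And>k. N \<subseteq> G k" and f: "continuous_on (G 0) f"
    and pos: "dyadic_content n (f ` N) \<noteq> 0"
  obtains K where "compact K" "\<And>k. K \<subseteq> G k" "hausdorff_measure (\<lambda>t. ennreal (t ^ n)) (f ` K) \<noteq> 0"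
proof -
  \<comment> \<open>One threshold strictly below the content serves for all stages. It is finite, as
    continuity from below requires.\<close>
  obtain t where t: "0 < t" "t < dyadic_content n (f ` N)"
    using pos dense[of 0 "dyadic_content n (f ` N)"] by (auto simp: zero_less_iff_neq_zero)
  then have "t < top" using less_trans top.not_eq_extremum by (metis not_top_less order_less_imp_not_eq2)
  then obtain c where c: "t = ennreal c" "0 < c" using t(1) by (cases t) auto
  \<comment> \<open>\<open>B\<close> is an arbitrary set, and only its closure is compact: content
    is tracked on subsets of \<open>N\<close>, compactness on their closures.\<close>
  have shrink: "\<exists>B\<subseteq>A. t < dyadic_content n (f ` B) \<and> compact (closure B) \<and> closure B \<subseteq> G k"
    if "A \<subseteq> N" and A: "t < dyadic_content n (f ` A)" for A k
  proof -
    obtain C where C: "\<And>j. compact (C j)" "\<And>j. C j \<subseteq> G k" "\<And>j. C j \<subseteq> interior (C (Suc j))"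
      "\<Union>(range C) = G k"
      using open_Union_compact_subsets[OF G(1)[of k]] by metis
    have "C j \<subseteq> C (Suc j)" for j using C(3) interior_subset by blast
    then have "incseq C" by (rule incseq_SucI)
    have "\<exists>j. t < dyadic_content n (f ` (A \<inter> C j))"
    proof (rule ccontr)
      assume "\<nexists>j. t < dyadic_content n (f ` (A \<inter> C j))"
      then have "dyadic_content n (\<Union>j. f ` (A \<inter> C j)) \<le> t"
        using \<open>incseq C\<close> \<open>t < top\<close>
        by (intro dyadic.cover_content_UN_incseq_le) (fastforce simp: incseq_def not_less)+
      moreover have "f ` (A \<inter> \<Union>(range C)) = (\<Union>j. f ` (A \<inter> C j))"
        unfolding Int_UN_distrib image_UN ..
      moreover have "A \<inter> \<Union>(range C) = A"
        unfolding C(4) using G(2)[of k] \<open>A \<subseteq> N\<close> by blast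
      ultimately show False using A by simp
    qed
    then obtain j where j: "t < dyadic_content n (f ` (A \<inter> C j))" ..
    have "closure (A \<inter> C j) \<subseteq> C j"
      using C(1) by (intro closure_minimal) (auto simp: compact_imp_closed)
    moreover have "bounded (A \<inter> C j)"
      using C(1)[of j] by (intro bounded_subset[OF compact_imp_bounded]) auto
    ultimately show ?thesis using j C(2)[of j]
      by (intro exI[of _ "A \<inter> C j"]) (auto simp: compact_closure)
  qed
  define ok where "ok k A \<longleftrightarrow> A \<subseteq> N \<and> t < dyadic_content n (f ` A) \<and> compact (closure A) \<and> closure A \<subseteq> G k"
    for k A
  have "\<exists>A. ok 0 A" using shrink[of N 0] t(2) by (auto simp: ok_def)
  moreover have "\<exists>B. ok (Suc k) B \<and> B \<subseteq> A" if "ok k A" for k A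
    using shrink[of A "Suc k"] that unfolding ok_def by (meson order_trans)
  ultimately obtain A where A: "\<And>k. ok k (A k)" "\<And>k. A (Suc k) \<subseteq> A k"
    using dependent_nat_choice[of ok "\<lambda>k A B. B \<subseteq> A"] by metis
  have decA: "A l \<subseteq> A k" if "k \<le> l" for k l using A(2) that by (rule lift_Suc_antimono_le)
  \<comment> \<open>Closures may leave \<open>N\<close>, but they stay inside the sets
    \<open>G k\<close>.\<close>
  define K where "K = (\<Inter>k. closure (A k))"
  have KG: "K \<subseteq> G k" for k using A(1)[of k] unfolding K_def ok_def by blast
  have "compact K"
    unfolding K_def by (rule compact_Inter) (use A(1) in \<open>auto simp: ok_def\<close>)
  moreover have "hausdorff_measure (\<lambda>t. ennreal (t ^ n)) (f ` K) \<noteq> 0"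
  proof
    assume "hausdorff_measure (\<lambda>t. ennreal (t ^ n)) (f ` K) = 0"
    then obtain V where V: "open V" "f ` K \<subseteq> V" "dyadic_content n V \<le> ennreal c"
      using hausdorff_null_open_hull_dyadic \<open>0 < c\<close> by blast
    define W where "W = G 0 \<inter> f -` V"
    have "open W" unfolding W_def by (rule continuous_open_preimage[OF f G(1) V(1)])
    \<comment> \<open>These compact sets decrease and their intersection \<open>K - W\<close> is
      empty, so one of them is already empty.\<close>
    have "\<exists>k. closure (A k) - W = {}"
    proof (rule ccontr)
      assume "\<nexists>k. closure (A k) - W = {}"
      then have "(\<Inter>k. closure (A k) - W) \<noteq> {}"
      proof (intro compact_nest)
        show "compact (closure (A k) - W)" for k
          using A(1)[of k] \<open>open W\<close> by (auto simp: ok_def intro!: compact_diff)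
        show "closure (A l) - W \<subseteq> closure (A k) - W" if "k \<le> l" for k l
          using closure_mono[OF decA[OF that]] by blast
      qed blast
      then have "\<not> K \<subseteq> W" unfolding K_def by blast
      then show False using V(2) KG[of 0] by (auto simp: W_def)
    qed
    then obtain k where "closure (A k) \<subseteq> W" by blast
    then have "f ` A k \<subseteq> V" using closure_subset[of "A k"] by (auto simp: W_def)
    then have "dyadic_content n (f ` A k) \<le> t"
      using V(3) c(1) dyadic.cover_content_mono order_trans by metis
    then show False using A(1)[of k] unfolding ok_def by (meson leD)
  qed
  ultimately show thesis using KG that by blast
qed

section \<open>Assembly of the Cantor set\<close>

theorem theorem6p1:
  fixes \<Omega> :: "(real ^ 'n) set" and f :: "real ^ 'n \<Rightarrow> real ^ 'd"
    and \<phi> :: "real \<Rightarrow> ennreal" and N :: "(real ^ 'n) set"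
  assumes "CARD('n) \<ge> 2"
    and "open \<Omega>"
    and "continuous_on \<Omega> f"
    and "gauge_function \<phi>"
    and "N \<subseteq> \<Omega>"
    and "hausdorff_measure \<phi> N = 0"
    and "hausdorff_measure (\<lambda>t. ennreal (t ^ CARD('n))) (f ` N) > 0"
  shows "\<exists>K. cantor_set K \<and> K \<subseteq> \<Omega> \<and> hausdorff_measure \<phi> K = 0 \<and>
             hausdorff_measure (\<lambda>t. ennreal (t ^ CARD('n))) (f ` K) > 0"
proof -
  let ?n = "CARD('n)"
  let ?h = "\<lambda>t. ennreal (t ^ CARD('n))"
  have "dyadic_content ?n (f ` N) \<noteq> 0"
    using assms(7) hausdorff_measure_null_of_dyadic_content[of ?n "f ` N"] by auto
  then obtain N' D where N': "N' \<subseteq> N" "dyadic_content ?n (f ` N') \<noteq> 0"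
    and D: "\<And>i. countable (D i)" "\<And>i. order_dense (D i)" "\<And>i x. x \<in> N' \<Longrightarrow> x $ i \<notin> D i"
    using subset_avoiding_dense_coordinates by blast
  have "\<exists>U. open U \<and> N \<subseteq> U \<and> hausdorff_approx \<phi> (1 / real (Suc k)) U < ennreal (1 / real (Suc k))" for k
    using hausdorff_null_open_hull[OF assms(4,6), of "1 / real (Suc k)"] by (metis of_nat_0_less_iff zero_less_Suc zero_less_divide_1_iff)
  then obtain U where U: "\<And>k. open (U k)" "\<And>k. N \<subseteq> U k"
    "\<And>k. hausdorff_approx \<phi> (1 / real (Suc k)) (U k) < ennreal (1 / real (Suc k))" by metis
  \<comment> \<open>All open conditions to be imposed: the hulls \<open>U k\<close> make the compact
    set \<phi>-null, and the complements of the hyperplanes \<open>x $ i = q\<close> make it totally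
    disconnected. They are countable in number, so their intersection is a G-delta set.\<close>
  define \<O> where "\<O> = range U \<union> (\<Union>i. (\<lambda>q. {x. x $ i \<noteq> q}) ` D i)"
  \<comment> \<open>Intersecting with \<open>\<Omega>\<close> keeps the compact set in the domain
    and makes \<open>f\<close> continuous on \<open>G 0\<close>.\<close>
  define G where "G k = \<Omega> \<inter> from_nat_into \<O> k" for k
  have "\<O> \<noteq> {}" "countable \<O>" using D(1) by (auto simp: \<O>_def)
  have "open T" if "T \<in> \<O>" for T
  proof -
    have "open {x :: real ^ 'n. x $ i \<noteq> q}" for i q
      by (intro open_Collect_neq continuous_intros)
    then show ?thesis using that U(1) by (auto simp: \<O>_def)
  qed
  then have "open (G k)" for k
    using assms(2) from_nat_into[OF \<open>\<O> \<noteq> {}\<close>] by (auto simp: G_def)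
  moreover have "N' \<subseteq> T" if "T \<in> \<O>" for T using that U(2) N'(1) D(3) by (auto simp: \<O>_def)
  then have "N' \<subseteq> G k" for k
    using assms(5) N'(1) from_nat_into[OF \<open>\<O> \<noteq> {}\<close>] unfolding G_def by blast
  moreover have "continuous_on (G 0) f"
    by (rule continuous_on_subset[OF assms(3)]) (simp add: G_def)
  ultimately obtain K where K: "compact K" "\<And>k. K \<subseteq> G k" "hausdorff_measure ?h (f ` K) \<noteq> 0"
    using compact_subset_positive_image N'(2) by metis
  have K\<O>: "K \<subseteq> T" if "T \<in> \<O>" for T
    using from_nat_into_surj[OF \<open>countable \<O>\<close> that] K(2) unfolding G_def by blast
  obtain P where P: "P \<subseteq> K" "compact P" "countable (K - P)" "\<And>x. x \<in> P \<Longrightarrow> x islimpt P"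
    using perfect_kernel[OF K(1)] by metis
  have P\<O>: "P \<subseteq> T" if "T \<in> \<O>" for T using K\<O>[OF that] P(1) by blast
  \<comment> \<open>Only countably many points of \<open>K\<close> are lost. Their images are null
    because the power gauge vanishes at 0, and null sets are stable under unions by way of the
    content.\<close>
  have posP: "hausdorff_measure ?h (f ` P) \<noteq> 0"
  proof
    assume "hausdorff_measure ?h (f ` P) = 0"
    moreover have "hausdorff_measure ?h (f ` (K - P)) = 0"
      using P(3) by (intro hausdorff_measure_countable) auto
    ultimately have "dyadic_content ?n (f ` P \<union> f ` (K - P)) = 0"
      by (intro dyadic.cover_content_Un_null dyadic_content_null)
    moreover have "f ` P \<union> f ` (K - P) = f ` K" using P(1) by blast
    ultimately show False using K(3) hausdorff_measure_null_of_dyadic_content[of ?n "f ` K"] by simp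
  qed
  have "hausdorff_measure \<phi> P = 0"
  proof (rule hausdorff_measure_eq_0I)
    fix \<delta> e :: real assume "0 < \<delta>" "0 < e"
    \<comment> \<open>\<open>1 / real (Suc k)\<close> bounds both the scale and the weight of the
      cover of \<open>U k\<close>, hence the minimum of \<open>\<delta>\<close> and
      \<open>e\<close>.\<close>
    then obtain k where k: "1 / real (Suc k) < min \<delta> e"
      using nat_approx_posE[of "min \<delta> e"] by auto
    have "P \<subseteq> U k" by (rule P\<O>) (simp add: \<O>_def)
    then have "hausdorff_approx \<phi> \<delta> P \<le> hausdorff_approx \<phi> (1 / real (Suc k)) (U k)"
      using k by (intro hausdorff_approx_antimono) auto
    also have "\<dots> \<le> ennreal (1 / real (Suc k))" using U(3) by (rule less_imp_le)
    also have "\<dots> \<le> ennreal e" using k by (intro ennreal_leI) simp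
    finally show "hausdorff_approx \<phi> \<delta> P \<le> ennreal e" .
  qed
  moreover have "P \<noteq> {}"
    using posP hausdorff_measure_countable[of "{}" ?h] by auto
  moreover have "perfect_set P" using P(2,4) by (simp add: perfect_set_def compact_imp_closed)
  moreover have "totally_disconnected P"
  proof (rule totally_disconnected_if_coordinates_avoid[OF D(2)])
    fix i x assume "x \<in> P"
    show "x $ i \<notin> D i"
    proof
      assume "x $ i \<in> D i"
      then have "P \<subseteq> {y. y $ i \<noteq> x $ i}" by (intro P\<O>) (auto simp: \<O>_def)
      then show False using \<open>x \<in> P\<close> by blast
    qed
  qed
  moreover have "P \<subseteq> \<Omega>" using P(1) K(2)[of 0] by (auto simp: G_def)
  ultimately show ?thesis
    using P(2) posP by (auto simp: cantor_set_def zero_less_iff_neq_zero)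
qed

end
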